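(* Suppose $d=1$. Let $\varphi:\mathbb{R}^2\to\mathbb{R}$ be final-time data, and let $u^\varepsilon(t,m,\xi,\eta)$ be the scaled value function defined by the dynamic programming principle (see context) with $u^\varepsilon(T,m,\xi,\eta)=\varphi(\xi,\eta)$. Let $$C_1^\#=\frac{(q(1)-r(1))^2+(q(0)-r(0))^2}{2},$$ and let $u(t,\xi,\eta)$ be a solution of $$u_t+\tfrac12 C_1^\#\Big\langle D^2u\,\frac{\nabla^\perp u}{u_\eta},\frac{\nabla^\perp u}{u_\eta}\Big\rangle=0\ \ (t<T),\qquad u(T,\xi,\eta)=\varphi(\xi,\eta).$$ Assume that $u$ satisfies: (i) $u$ has continuous, uniformly bounded derivatives in $(\xi,\eta)$ of order up to $4$; $u_t$ has continuous, uniformly bounded derivatives in $(\xi,\eta)$ of order up to $2$; and $u_{tt}$ is continuous and uniformly bounded, all bounds being uniform as $t\uparrow T$; (ii) $u_\eta>c>0$ for some constant $c$ uniform in space and time; (iii) $|u_\xi|\le u_\eta$. Then there is a constant $C$ (independent of $\varepsilon$, $t$, and $T$) such that $$u^\varepsilon(t,m,\xi,\eta)\le u(t,\xi,\eta)+C\,[(T-t)+\varepsilon]\,\varepsilon\qquad\text{for } t<T,\ \xi\in\mathbb{R},\ \eta\in\mathbb{R},\ m\in\{0,1\},$$ whenever $\varepsilon>0$ is small enough and $t$ is such that $N=(T-t)/\varepsilon^2$ is an integer.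
   Context: The states are $m\in\{0,1\}$; for $b=\pm1$ the next state is $m_b=1$ if $b=1$ and $m_b=0$ if $b=-1$. Two experts are given by functions $q,r:\{0,1\}\to\mathbb{R}$ with $|q(m)|<1$ and $|r(m)|<1$ for all $m$, and $q(m)\ne r(m)$ for at least one $m$. For $\varepsilon>0$, $u^\varepsilon(t,m,\xi,\eta)$ is defined for times $t\le T$ with $(T-t)/\varepsilon^2$ a nonnegative integer, $m\in\{0,1\}$, $(\xi,\eta)\in\mathbb{R}^2$, by $u^\varepsilon(T,m,\xi,\eta)=\varphi(\xi,\eta)$ and, working backward in time, $$u^\varepsilon(t,m,\xi,\eta)=\min_{|f|\le1}\max_{b=\pm1}u^\varepsilon\big(t+\varepsilon^2,\,m_b,\,\xi+\varepsilon b[q(m)-r(m)],\,\eta+\varepsilon b[q(m)+r(m)-2f]\big).$$ Notation: $\nabla^\perp u=(-u_\eta,u_\xi)$ and $D^2u$ is the Hessian of $u$ in $(\xi,\eta)$. *)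

theory Defs
  imports "HOL-Analysis.Analysis"
begin

section \<open>The scaled value function\<close>

text \<open>The states are the natural numbers 0 and 1, and market moves are the reals 1 and -1.
  The experts \<open>q\<close>, \<open>r\<close> are only ever evaluated at the states 0 and 1.\<close>

definition next_state :: "real \<Rightarrow> nat" where
  "next_state b = (if b = 1 then 1 else 0)"

definition worst_case ::
    "(nat \<Rightarrow> real) \<Rightarrow> (nat \<Rightarrow> real) \<Rightarrow> real \<Rightarrow> (nat \<Rightarrow> real \<Rightarrow> real \<Rightarrow> real)
      \<Rightarrow> nat \<Rightarrow> real \<Rightarrow> real \<Rightarrow> real \<Rightarrow> real" where
  "worst_case q r \<epsilon> w m \<xi> \<eta> f =
     (MAX b\<in>{-1, 1}. w (next_state b) (\<xi> + \<epsilon> * b * (q m - r m))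
                                        (\<eta> + \<epsilon> * b * (q m + r m - 2 * f)))"

text \<open>The minimum over \<open>\<bar>f\<bar> \<le> 1\<close> is written as an infimum; for continuous final data it is
  attained (\<open>dp_step_attained\<close> below).\<close>

definition dp_step ::
    "(nat \<Rightarrow> real) \<Rightarrow> (nat \<Rightarrow> real) \<Rightarrow> real \<Rightarrow> (nat \<Rightarrow> real \<Rightarrow> real \<Rightarrow> real)
      \<Rightarrow> nat \<Rightarrow> real \<Rightarrow> real \<Rightarrow> real" where
  "dp_step q r \<epsilon> w m \<xi> \<eta> = (INF f\<in>{f. \<bar>f\<bar> \<le> 1}. worst_case q r \<epsilon> w m \<xi> \<eta> f)"

primrec value_iter ::
    "(nat \<Rightarrow> real) \<Rightarrow> (nat \<Rightarrow> real) \<Rightarrow> real \<Rightarrow> (real \<Rightarrow> real \<Rightarrow> real) \<Rightarrow> nat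
      \<Rightarrow> nat \<Rightarrow> real \<Rightarrow> real \<Rightarrow> real" where
  "value_iter q r \<epsilon> \<phi> 0 = (\<lambda>m. \<phi>)"
| "value_iter q r \<epsilon> \<phi> (Suc N) = dp_step q r \<epsilon> (value_iter q r \<epsilon> \<phi> N)"

text \<open>Meaningful when \<open>\<epsilon> > 0\<close>, \<open>t \<le> T\<close> and \<open>(T - t) / \<epsilon>\<^sup>2\<close> is an integer; the floor only
  converts that number to a natural number. The lemmas \<open>scaled_value_final\<close> and
  \<open>scaled_value_dpp\<close> are the final condition and the dynamic programming principle.\<close>

definition scaled_value ::
    "(nat \<Rightarrow> real) \<Rightarrow> (nat \<Rightarrow> real) \<Rightarrow> real \<Rightarrow> (real \<Rightarrow> real \<Rightarrow> real) \<Rightarrow> real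
      \<Rightarrow> real \<Rightarrow> nat \<Rightarrow> real \<Rightarrow> real \<Rightarrow> real" where
  "scaled_value q r T \<phi> \<epsilon> t = value_iter q r \<epsilon> \<phi> (nat \<lfloor>(T - t) / \<epsilon>\<^sup>2\<rfloor>)"

lemma scaled_value_final: "scaled_value q r T \<phi> \<epsilon> T m \<xi> \<eta> = \<phi> \<xi> \<eta>"
  by (simp add: scaled_value_def)

lemma scaled_value_dpp:
  assumes "\<epsilon> > 0" "t < T" "(T - t) / \<epsilon>\<^sup>2 \<in> \<nat>"
  shows "scaled_value q r T \<phi> \<epsilon> t m \<xi> \<eta> =
    (INF f\<in>{f. \<bar>f\<bar> \<le> 1}. MAX b\<in>{-1, 1}.
       scaled_value q r T \<phi> \<epsilon> (t + \<epsilon>\<^sup>2) (next_state b)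
         (\<xi> + \<epsilon> * b * (q m - r m)) (\<eta> + \<epsilon> * b * (q m + r m - 2 * f)))"
proof -
  obtain n where n: "(T - t) / \<epsilon>\<^sup>2 = real n"
    using assms(3) by (auto elim: Nats_cases)
  with assms have "n \<noteq> 0" by (intro notI) simp
  then obtain k where k: "n = Suc k" using not0_implies_Suc by blast
  have "(T - (t + \<epsilon>\<^sup>2)) / \<epsilon>\<^sup>2 = (T - t) / \<epsilon>\<^sup>2 - 1"
    using assms(1) by (simp add: field_simps)
  then have "(T - (t + \<epsilon>\<^sup>2)) / \<epsilon>\<^sup>2 = real k"
    using n k by simp
  moreover have "nat \<lfloor>(T - t) / \<epsilon>\<^sup>2\<rfloor> = Suc k"
    unfolding n k by (simp only: floor_of_nat nat_int)
  ultimately show ?thesis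
    by (simp add: scaled_value_def dp_step_def worst_case_def)
qed

lemma worst_case_alt:
  "worst_case q r \<epsilon> w m \<xi> \<eta> f =
     max (w 0 (\<xi> - \<epsilon> * (q m - r m)) (\<eta> - \<epsilon> * (q m + r m - 2 * f)))
         (w 1 (\<xi> + \<epsilon> * (q m - r m)) (\<eta> + \<epsilon> * (q m + r m - 2 * f)))"
  by (simp add: worst_case_def next_state_def)

lemma worst_case_continuous:
  assumes "\<And>m. continuous_on UNIV (\<lambda>(\<xi>, \<eta>). w m \<xi> \<eta>)"
  shows "continuous_on UNIV (\<lambda>((\<xi>, \<eta>), f). worst_case q r \<epsilon> w m \<xi> \<eta> f)"
proof -
  have w: "continuous_on UNIV (\<lambda>z. w m' (g z) (h z))"
    if "continuous_on UNIV g" "continuous_on UNIV h"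
    for m' and g h :: "(real \<times> real) \<times> real \<Rightarrow> real"
    using continuous_on_compose2[OF assms[of m'] continuous_on_Pair[OF that]] by simp
  show ?thesis
    unfolding worst_case_alt case_prod_beta
    by (intro continuous_intros w)
qed

lemma abs_le_1_compact: "compact {f::real. \<bar>f\<bar> \<le> 1}" "{f::real. \<bar>f\<bar> \<le> 1} \<noteq> {}"
proof -
  have "{f::real. \<bar>f\<bar> \<le> 1} = {-1..1}" by auto
  then show "compact {f::real. \<bar>f\<bar> \<le> 1}" by simp
  show "{f::real. \<bar>f\<bar> \<le> 1} \<noteq> {}" by (auto intro: exI[of _ 0])
qed

lemma dp_step_attained:
  assumes "\<And>m. continuous_on UNIV (\<lambda>(\<xi>, \<eta>). w m \<xi> \<eta>)"
  shows "\<exists>f. \<bar>f\<bar> \<le> 1 \<and> dp_step q r \<epsilon> w m \<xi> \<eta> = worst_case q r \<epsilon> w m \<xi> \<eta> f \<and>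
    (\<forall>g. \<bar>g\<bar> \<le> 1 \<longrightarrow> worst_case q r \<epsilon> w m \<xi> \<eta> f \<le> worst_case q r \<epsilon> w m \<xi> \<eta> g)"
proof -
  have "continuous_on UNIV (\<lambda>f. (\<lambda>((\<xi>, \<eta>), f). worst_case q r \<epsilon> w m \<xi> \<eta> f) ((\<xi>, \<eta>), f))"
    by (rule continuous_on_compose2[OF worst_case_continuous[OF assms]])
       (auto intro!: continuous_intros)
  then have "continuous_on {f. \<bar>f\<bar> \<le> 1} (worst_case q r \<epsilon> w m \<xi> \<eta>)"
    by (simp add: continuous_on_subset[OF _ subset_UNIV])
  from continuous_attains_inf[OF abs_le_1_compact this]
  obtain f where f: "\<bar>f\<bar> \<le> 1"
    "\<And>g. \<bar>g\<bar> \<le> 1 \<Longrightarrow> worst_case q r \<epsilon> w m \<xi> \<eta> f \<le> worst_case q r \<epsilon> w m \<xi> \<eta> g"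
    by auto
  then have "dp_step q r \<epsilon> w m \<xi> \<eta> = worst_case q r \<epsilon> w m \<xi> \<eta> f"
    unfolding dp_step_def by (intro cInf_eq_minimum) auto
  with f show ?thesis by blast
qed

lemma dp_step_continuous:
  assumes "\<And>m. continuous_on UNIV (\<lambda>(\<xi>, \<eta>). w m \<xi> \<eta>)"
  shows "continuous_on UNIV (\<lambda>(\<xi>, \<eta>). dp_step q r \<epsilon> w m \<xi> \<eta>)"
proof -
  define F where "F = (\<lambda>((\<xi>, \<eta>), f). worst_case q r \<epsilon> w m \<xi> \<eta> f)"
  have F: "continuous_on (UNIV \<times> {f. \<bar>f\<bar> \<le> 1}) F"
    using worst_case_continuous[OF assms] unfolding F_def
    by (rule continuous_on_subset) auto
  let ?d = "\<lambda>z. dp_step q r \<epsilon> w m (fst z) (snd z)"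
  have att: "\<exists>f. \<bar>f\<bar> \<le> 1 \<and> ?d z = F (z, f) \<and> (\<forall>g. \<bar>g\<bar> \<le> 1 \<longrightarrow> ?d z \<le> F (z, g))" for z
  proof -
    obtain f where f: "\<bar>f\<bar> \<le> 1" "?d z = worst_case q r \<epsilon> w m (fst z) (snd z) f"
      "\<forall>g. \<bar>g\<bar> \<le> 1 \<longrightarrow> worst_case q r \<epsilon> w m (fst z) (snd z) f
         \<le> worst_case q r \<epsilon> w m (fst z) (snd z) g"
      using dp_step_attained[of w q r \<epsilon> m "fst z" "snd z", OF assms] by blast
    have "F (z, g) = worst_case q r \<epsilon> w m (fst z) (snd z) g" for g
      by (simp add: F_def case_prod_beta)
    with f show ?thesis by (intro exI[of _ f]) simp
  qed
  have "\<exists>d>0. \<forall>z. dist z z0 < d \<longrightarrow> dist (?d z) (?d z0) < e" if "e > 0" for z0 e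
  proof -
    from \<open>e > 0\<close> have "e / 2 > 0" by simp
    from continuous_on_prod_compactE[OF F abs_le_1_compact(1) UNIV_I this, of z0]
    obtain X where "z0 \<in> X" "open X" and
      X: "\<forall>z\<in>X \<inter> UNIV. \<forall>f\<in>{f. \<bar>f\<bar> \<le> 1}. dist (F (z, f)) (F (z0, f)) \<le> e / 2"
      by metis
    then obtain d where d: "d > 0" "\<And>z. dist z z0 < d \<Longrightarrow> z \<in> X"
      unfolding open_dist by blast
    have "dist (?d z) (?d z0) < e" if "dist z z0 < d" for z
    proof -
      have z: "\<bar>F (z, f) - F (z0, f)\<bar> \<le> e / 2" if "\<bar>f\<bar> \<le> 1" for f
        using X d(2)[OF \<open>dist z z0 < d\<close>] that by (simp add: dist_real_def)
      obtain f where f: "\<bar>f\<bar> \<le> 1" "?d z = F (z, f)" "\<forall>g. \<bar>g\<bar> \<le> 1 \<longrightarrow> ?d z \<le> F (z, g)"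
        using att by blast
      obtain f0 where f0: "\<bar>f0\<bar> \<le> 1" "?d z0 = F (z0, f0)"
          "\<forall>g. \<bar>g\<bar> \<le> 1 \<longrightarrow> ?d z0 \<le> F (z0, g)"
        using att by blast
      have "?d z \<le> F (z, f0)" "?d z0 \<le> F (z0, f)" using f f0 by blast+
      with z[OF f(1)] z[OF f0(1)] f(2) f0(2) \<open>e > 0\<close> show ?thesis
        unfolding dist_real_def by linarith
    qed
    with d show ?thesis by blast
  qed
  then have "continuous_on UNIV ?d"
    unfolding continuous_on_iff by simp
  then show ?thesis by (simp add: case_prod_beta)
qed

lemma value_iter_continuous:
  assumes "continuous_on UNIV (\<lambda>(\<xi>, \<eta>). \<phi> \<xi> \<eta>)"
  shows "continuous_on UNIV (\<lambda>(\<xi>, \<eta>). value_iter q r \<epsilon> \<phi> N m \<xi> \<eta>)"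
  by (induction N arbitrary: m) (simp_all add: assms dp_step_continuous)


section \<open>The limiting equation\<close>

definition D_t :: "(real \<Rightarrow> real \<Rightarrow> real \<Rightarrow> real) \<Rightarrow> real \<Rightarrow> real \<Rightarrow> real \<Rightarrow> real" where
  "D_t u t \<xi> \<eta> = deriv (\<lambda>s. u s \<xi> \<eta>) t"

definition D_xi :: "(real \<Rightarrow> real \<Rightarrow> real \<Rightarrow> real) \<Rightarrow> real \<Rightarrow> real \<Rightarrow> real \<Rightarrow> real" where
  "D_xi u t \<xi> \<eta> = deriv (\<lambda>x. u t x \<eta>) \<xi>"

definition D_eta :: "(real \<Rightarrow> real \<Rightarrow> real \<Rightarrow> real) \<Rightarrow> real \<Rightarrow> real \<Rightarrow> real \<Rightarrow> real" where
  "D_eta u t \<xi> \<eta> = deriv (\<lambda>y. u t \<xi> y) \<eta>"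

definition grad_perp :: "(real \<Rightarrow> real \<Rightarrow> real \<Rightarrow> real) \<Rightarrow> real \<Rightarrow> real \<Rightarrow> real \<Rightarrow> real^2" where
  "grad_perp u t \<xi> \<eta> = vector [- D_eta u t \<xi> \<eta>, D_xi u t \<xi> \<eta>]"

definition hessian :: "(real \<Rightarrow> real \<Rightarrow> real \<Rightarrow> real) \<Rightarrow> real \<Rightarrow> real \<Rightarrow> real \<Rightarrow> real^2^2" where
  "hessian u t \<xi> \<eta> =
     vector [vector [D_xi (D_xi u) t \<xi> \<eta>, D_xi (D_eta u) t \<xi> \<eta>],
             vector [D_eta (D_xi u) t \<xi> \<eta>, D_eta (D_eta u) t \<xi> \<eta>]]"

definition C_sharp_1 :: "(nat \<Rightarrow> real) \<Rightarrow> (nat \<Rightarrow> real) \<Rightarrow> real" where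
  "C_sharp_1 q r = ((q 1 - r 1)\<^sup>2 + (q 0 - r 0)\<^sup>2) / 2"

definition solves_final_value_problem ::
    "real \<Rightarrow> real \<Rightarrow> (real \<Rightarrow> real \<Rightarrow> real) \<Rightarrow> (real \<Rightarrow> real \<Rightarrow> real \<Rightarrow> real) \<Rightarrow> bool" where
  "solves_final_value_problem C1 T \<phi> u \<longleftrightarrow>
     (\<forall>t<T. \<forall>\<xi> \<eta>.
        let w = grad_perp u t \<xi> \<eta> /\<^sub>R D_eta u t \<xi> \<eta>
        in D_t u t \<xi> \<eta> + 1 / 2 * C1 * ((hessian u t \<xi> \<eta> *v w) \<bullet> w) = 0) \<and>
     (\<forall>\<xi> \<eta>. u T \<xi> \<eta> = \<phi> \<xi> \<eta>)"


section \<open>Regularity\<close>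

text \<open>\<open>bdd_cont K T g\<close>: on \<open>t < T\<close> the function \<open>g\<close> is jointly continuous in
  \<open>(t, \<xi>, \<eta>)\<close> and bounded by \<open>K\<close>. The bound is uniform as \<open>t\<close> approaches \<open>T\<close>.\<close>

definition bdd_cont :: "real \<Rightarrow> real \<Rightarrow> (real \<Rightarrow> real \<Rightarrow> real \<Rightarrow> real) \<Rightarrow> bool" where
  "bdd_cont K T g \<longleftrightarrow>
     continuous_on ({..<T} \<times> UNIV) (\<lambda>(t, \<xi>, \<eta>). g t \<xi> \<eta>) \<and>
     (\<forall>t<T. \<forall>\<xi> \<eta>. \<bar>g t \<xi> \<eta>\<bar> \<le> K)"

definition t_differentiable :: "real \<Rightarrow> (real \<Rightarrow> real \<Rightarrow> real \<Rightarrow> real) \<Rightarrow> bool" where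
  "t_differentiable T g \<longleftrightarrow>
     (\<forall>t<T. \<forall>\<xi> \<eta>. (\<lambda>s. g s \<xi> \<eta>) differentiable at t)"

definition space_differentiable :: "real \<Rightarrow> (real \<Rightarrow> real \<Rightarrow> real \<Rightarrow> real) \<Rightarrow> bool" where
  "space_differentiable T g \<longleftrightarrow>
     (\<forall>t<T. \<forall>\<xi> \<eta>. (\<lambda>x. g t x \<eta>) differentiable at \<xi> \<and> (\<lambda>y. g t \<xi> y) differentiable at \<eta>)"

text \<open>\<open>bdd_space_derivs K T k g\<close>: the function \<open>g\<close> itself and all its iterated partial
  derivatives in \<open>(\<xi>, \<eta>)\<close> of order at most \<open>k\<close>, taken in any order, exist on \<open>t < T\<close>,
  are continuous, and are bounded by \<open>K\<close>.\<close>

primrec bdd_space_derivs ::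
    "real \<Rightarrow> real \<Rightarrow> nat \<Rightarrow> (real \<Rightarrow> real \<Rightarrow> real \<Rightarrow> real) \<Rightarrow> bool" where
  "bdd_space_derivs K T 0 g \<longleftrightarrow> bdd_cont K T g"
| "bdd_space_derivs K T (Suc k) g \<longleftrightarrow>
     bdd_cont K T g \<and> space_differentiable T g \<and>
     bdd_space_derivs K T k (D_xi g) \<and> bdd_space_derivs K T k (D_eta g)"

text \<open>The function \<open>u\<close> itself is not assumed bounded (which would contradict a positive lower
  bound on its derivative in \<open>\<eta>\<close>): the bounds concern its spatial derivatives of order 1 to 4.
  All derivatives are required for \<open>t < T\<close> only; continuity of \<open>u\<close> on \<open>t \<le> T\<close> is what ties
  \<open>u\<close> to its final-time data.\<close>

definition regular_solution ::
    "real \<Rightarrow> real \<Rightarrow> (real \<Rightarrow> real \<Rightarrow> real \<Rightarrow> real) \<Rightarrow> bool" where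
  "regular_solution K T u \<longleftrightarrow>
     continuous_on ({..T} \<times> UNIV) (\<lambda>(t, \<xi>, \<eta>). u t \<xi> \<eta>) \<and>
     space_differentiable T u \<and>
     bdd_space_derivs K T 3 (D_xi u) \<and> bdd_space_derivs K T 3 (D_eta u) \<and>
     t_differentiable T u \<and> bdd_space_derivs K T 2 (D_t u) \<and>
     t_differentiable T (D_t u) \<and> bdd_cont K T (D_t (D_t u))"

end

theory Submission
  imports Defs
begin

text \<open>The proof is a verification argument: the player follows an explicit rule \<open>f\<close>, and a
  slightly corrected version of \<open>u\<close> is shown not to increase along the game, up to an
  error \<open>O(\<epsilon>\<^sup>3)\<close> per step.

  Write \<open>a = q m - r m\<close>. The rule \<open>f\<^sub>0 = (q m + r m + a u\<^sub>\<xi> / u\<^sub>\<eta>) / 2\<close> makes the displacement in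
  \<open>(\<xi>, \<eta>)\<close> orthogonal to the gradient of \<open>u\<close>, so the first-order term vanishes for both market
  moves. Since \<open>\<bar>u\<^sub>\<xi>\<bar> \<le> u\<^sub>\<eta>\<close>, it is a convex combination of the two experts and stays away from
  \<open>1\<close> and \<open>-1\<close>. What remains at order \<open>\<epsilon>\<^sup>2\<close> is \<open>u\<^sub>t + a\<^sup>2 Q / 2\<close>, where \<open>Q\<close> is the quadratic form of
  the Hessian at \<open>\<nabla>\<^sup>\<bottom>u / u\<^sub>\<eta>\<close>. The equation for \<open>u\<close> contains the average \<open>C\<close> of \<open>a\<^sup>2\<close> over the two
  states, so the remainder is \<open>\<kappa> m u\<^sub>t\<close> with \<open>\<kappa> m = 1 - a\<^sup>2 / C\<close>. This has no sign, but it
  averages out: \<open>\<kappa> 0 = - \<kappa> 1\<close>.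

  The averaging is realised by the corrected function \<open>u + \<epsilon>\<^sup>2 \<kappa> m u\<^sub>t\<close> together with the rule
  \<open>f\<^sub>0 + \<epsilon> \<kappa> 1 u\<^sub>t / (2 u\<^sub>\<eta>)\<close>. The new part of \<open>f\<close> contributes \<open>- \<epsilon>\<^sup>2 b \<kappa> 1 u\<^sub>t\<close> at market move
  \<open>b\<close>. The corrector at the next state contributes \<open>\<epsilon>\<^sup>2 \<kappa> m\<^sub>b u\<^sub>t = \<epsilon>\<^sup>2 b \<kappa> 1 u\<^sub>t\<close>, which cancels it,
  and the remainder \<open>\<epsilon>\<^sup>2 \<kappa> m u\<^sub>t\<close> is the corrector at the present state. As the corrector is a
  multiple of \<open>u\<^sub>t\<close>, its variation over one step is controlled by the assumed derivatives of
  \<open>u\<^sub>t\<close>.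

  The spatial expansion under this rule is \<open>control_expansion\<close>, and the resulting one-step
  inequality is \<open>interior_step\<close>. Derivatives are available for times before \<open>T\<close> only, so the step
  that ends at \<open>T\<close> is treated with a cruder error \<open>O(\<epsilon>\<^sup>2)\<close> in \<open>last_step\<close>, as a limit of times
  below \<open>T\<close>. Over \<open>(T - t) / \<epsilon>\<^sup>2\<close> steps the errors add up to \<open>O((T - t) \<epsilon> + \<epsilon>\<^sup>2)\<close>
  (\<open>value_iter_le\<close>), and dropping the corrector at time \<open>t\<close> costs another \<open>O(\<epsilon>\<^sup>2)\<close>.\<close>


section \<open>Taylor expansion with an explicit remainder\<close>

lemma taylor_order1:
  fixes g :: "real \<Rightarrow> real"
  assumes "\<And>x. (g has_real_derivative g1 x) (at x)" and "\<And>x. \<bar>g1 x\<bar> \<le> K"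
  shows "\<bar>g (x + h) - g x\<bar> \<le> K * \<bar>h\<bar>"
  using field_differentiable_bound[of UNIV g g1 K "x + h" x] assms by simp

lemma DERIV_shift_left:
  "(g has_real_derivative D) (at (x + y)) \<Longrightarrow> ((\<lambda>y. g (x + y)) has_real_derivative D) (at y)"
  using DERIV_shift[of g D y x] by (simp add: add.commute[of x])

lemma taylor_order2:
  fixes g :: "real \<Rightarrow> real"
  assumes "\<And>x. (g has_real_derivative g1 x) (at x)" "\<And>x. (g1 has_real_derivative g2 x) (at x)"
    and "\<And>x. \<bar>g2 x\<bar> \<le> K"
  shows "\<bar>g (x + h) - (g x + h * g1 x)\<bar> \<le> K * h\<^sup>2 / 2"
proof -
  define d where "d n y = (if n = 0 then g (x + y) else if n = 1 then g1 (x + y) else g2 (x + y))"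
    for n :: nat and y
  have "DERIV (d m) y :> d (Suc m) y" if "m < 2" for m y
    using that assms(1,2)[of "x + y"] unfolding d_def
    by (cases m) (auto intro: DERIV_shift_left)
  then have "\<forall>m t. m < 2 \<and> \<bar>t\<bar> \<le> \<bar>h\<bar> \<longrightarrow> DERIV (d m) t :> d (Suc m) t" by blast
  from Maclaurin_bi_le[OF refl this] obtain t where
    "d 0 h = (\<Sum>m<2. d m 0 / fact m * h ^ m) + d 2 t / fact 2 * h\<^sup>2" by blast
  then have "g (x + h) - (g x + h * g1 x) = g2 (x + t) * h\<^sup>2 / 2"
    by (simp add: d_def numeral_2_eq_2 algebra_simps)
  then show ?thesis using mult_right_mono[OF assms(3)[of "x + t"], of "h\<^sup>2"]
    by (simp only: abs_mult abs_divide power_abs) simp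
qed

lemma taylor_order3:
  fixes g :: "real \<Rightarrow> real"
  assumes "\<And>x. (g has_real_derivative g1 x) (at x)" "\<And>x. (g1 has_real_derivative g2 x) (at x)"
    and "\<And>x. (g2 has_real_derivative g3 x) (at x)" and "\<And>x. \<bar>g3 x\<bar> \<le> K"
  shows "\<bar>g (x + h) - (g x + h * g1 x + h\<^sup>2 / 2 * g2 x)\<bar> \<le> K * \<bar>h\<bar> ^ 3 / 6"
proof -
  define d where "d n y = (if n = 0 then g (x + y) else if n = 1 then g1 (x + y)
      else if n = 2 then g2 (x + y) else g3 (x + y))" for n :: nat and y
  have "DERIV (d m) y :> d (Suc m) y" if "m < 3" for m y
  proof -
    have "m = 0 \<or> m = 1 \<or> m = 2" using that by arith
    then show ?thesis using assms(1-3)[of "x + y"] unfolding d_def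
      by (auto intro: DERIV_shift_left)
  qed
  then have "\<forall>m t. m < 3 \<and> \<bar>t\<bar> \<le> \<bar>h\<bar> \<longrightarrow> DERIV (d m) t :> d (Suc m) t" by blast
  from Maclaurin_bi_le[OF refl this] obtain t where
    "d 0 h = (\<Sum>m<3. d m 0 / fact m * h ^ m) + d 3 t / fact 3 * h ^ 3" by blast
  then have "g (x + h) - (g x + h * g1 x + h\<^sup>2 / 2 * g2 x) = g3 (x + t) * h ^ 3 / 6"
    by (simp add: d_def eval_nat_numeral fact_numeral algebra_simps)
  then show ?thesis using mult_right_mono[OF assms(4)[of "x + t"], of "\<bar>h\<bar> ^ 3"]
    by (simp only: abs_mult abs_divide power_abs) simp
qed

text \<open>The increment is split into a move in \<open>y\<close> based at \<open>x + h\<close> and a move in \<open>x\<close>, and the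
  coefficients of the first are expanded in \<open>x\<close> again. This uses one-variable derivatives only,
  and the four remainders are the four terms of \<open>K (\<bar>h\<bar> + \<bar>k\<bar>)\<^sup>3 / 6\<close>.\<close>

lemma taylor_two_variables_iterated:
  fixes g :: "real \<Rightarrow> real \<Rightarrow> real"
  assumes x: "\<And>x y. ((\<lambda>x. g x y) has_real_derivative g1 x y) (at x)"
    "\<And>x y. ((\<lambda>x. g1 x y) has_real_derivative g11 x y) (at x)"
    "\<And>x y. ((\<lambda>x. g11 x y) has_real_derivative g111 x y) (at x)" "\<And>x y. \<bar>g111 x y\<bar> \<le> K"
    and y: "\<And>x y. ((\<lambda>y. g x y) has_real_derivative g2 x y) (at y)"
    "\<And>x y. ((\<lambda>y. g2 x y) has_real_derivative g22 x y) (at y)"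
    "\<And>x y. ((\<lambda>y. g22 x y) has_real_derivative g222 x y) (at y)" "\<And>x y. \<bar>g222 x y\<bar> \<le> K"
    and yx: "\<And>x y. ((\<lambda>x. g2 x y) has_real_derivative g21 x y) (at x)"
    "\<And>x y. ((\<lambda>x. g21 x y) has_real_derivative g211 x y) (at x)" "\<And>x y. \<bar>g211 x y\<bar> \<le> K"
    "\<And>x y. ((\<lambda>x. g22 x y) has_real_derivative g221 x y) (at x)" "\<And>x y. \<bar>g221 x y\<bar> \<le> K"
  shows "\<bar>g (x + h) (y + k) - (g x y + h * g1 x y + k * g2 x y
      + h\<^sup>2 / 2 * g11 x y + h * k * g21 x y + k\<^sup>2 / 2 * g22 x y)\<bar> \<le> K * (\<bar>h\<bar> + \<bar>k\<bar>) ^ 3 / 6"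
    (is "\<bar>?L\<bar> \<le> _")
proof -
  define A where "A = g (x + h) (y + k) - (g (x + h) y + k * g2 (x + h) y + k\<^sup>2 / 2 * g22 (x + h) y)"
  define B where "B = g (x + h) y - (g x y + h * g1 x y + h\<^sup>2 / 2 * g11 x y)"
  define R where "R = g2 (x + h) y - (g2 x y + h * g21 x y)"
  define S where "S = g22 (x + h) y - g22 x y"
  have A: "\<bar>A\<bar> \<le> K * \<bar>k\<bar> ^ 3 / 6" unfolding A_def by (rule taylor_order3[OF y])
  have B: "\<bar>B\<bar> \<le> K * \<bar>h\<bar> ^ 3 / 6" unfolding B_def
    by (rule taylor_order3[where g = "\<lambda>x. g x y", OF x])
  have "\<bar>R\<bar> \<le> K * h\<^sup>2 / 2" unfolding R_def
    by (rule taylor_order2[where g = "\<lambda>x. g2 x y", OF yx(1-3)])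
  from mult_left_mono[OF this, of "\<bar>k\<bar>"]
  have R: "\<bar>k * R\<bar> \<le> K * \<bar>h\<bar>\<^sup>2 * \<bar>k\<bar> / 2" by (simp add: abs_mult mult_ac)
  have "\<bar>S\<bar> \<le> K * \<bar>h\<bar>" unfolding S_def
    by (rule taylor_order1[where g = "\<lambda>x. g22 x y", OF yx(4,5)])
  from mult_left_mono[OF this, of "k\<^sup>2 / 2"]
  have S: "\<bar>k\<^sup>2 / 2 * S\<bar> \<le> K * \<bar>h\<bar> * \<bar>k\<bar>\<^sup>2 / 2" by (simp add: abs_mult mult_ac)
  have "?L = A + B + k * R + k\<^sup>2 / 2 * S"
    unfolding A_def B_def R_def S_def by (simp add: field_simps power2_eq_square)
  also have "\<bar>\<dots>\<bar> \<le> \<bar>A\<bar> + \<bar>B\<bar> + \<bar>k * R\<bar> + \<bar>k\<^sup>2 / 2 * S\<bar>" by linarith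
  also have "\<dots> \<le> K * \<bar>k\<bar> ^ 3 / 6 + K * \<bar>h\<bar> ^ 3 / 6 + K * \<bar>h\<bar>\<^sup>2 * \<bar>k\<bar> / 2 + K * \<bar>h\<bar> * \<bar>k\<bar>\<^sup>2 / 2"
    using A B R S by (intro add_mono)
  also have "\<dots> = K * (\<bar>h\<bar> + \<bar>k\<bar>) ^ 3 / 6"
    by (simp add: power3_eq_cube power2_eq_square field_simps del: abs_mult_self_eq)
  finally show ?thesis .
qed


section \<open>Partial derivatives of a regular solution\<close>

lemma D_xi_has_derivative:
  assumes "space_differentiable T g" "t < T"
  shows "((\<lambda>x. g t x \<eta>) has_real_derivative D_xi g t \<xi> \<eta>) (at \<xi>)"
  using assms unfolding space_differentiable_def D_xi_def
  by (simp add: DERIV_deriv_iff_real_differentiable)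

lemma D_eta_has_derivative:
  assumes "space_differentiable T g" "t < T"
  shows "((\<lambda>y. g t \<xi> y) has_real_derivative D_eta g t \<xi> \<eta>) (at \<eta>)"
  using assms unfolding space_differentiable_def D_eta_def
  by (simp add: DERIV_deriv_iff_real_differentiable)

lemma D_t_has_derivative:
  assumes "t_differentiable T g" "t < T"
  shows "((\<lambda>s. g s \<xi> \<eta>) has_real_derivative D_t g t \<xi> \<eta>) (at t)"
  using assms unfolding t_differentiable_def D_t_def
  by (simp add: DERIV_deriv_iff_real_differentiable)

lemma bdd_contD: "bdd_cont K T g \<Longrightarrow> t < T \<Longrightarrow> \<bar>g t \<xi> \<eta>\<bar> \<le> K"
  by (simp add: bdd_cont_def)

lemma bdd_space_derivs_bound: "bdd_space_derivs K T k g \<Longrightarrow> t < T \<Longrightarrow> \<bar>g t \<xi> \<eta>\<bar> \<le> K"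
  by (cases k) (auto dest: bdd_contD)

lemma space_lipschitz:
  assumes g: "bdd_space_derivs K T (Suc k) g" and t: "t < T"
  shows "\<bar>g t (\<xi> + h) (\<eta> + k') - g t \<xi> \<eta>\<bar> \<le> K * (\<bar>h\<bar> + \<bar>k'\<bar>)"
proof -
  have sd: "space_differentiable T g"
    and bd: "bdd_space_derivs K T k (D_xi g)" "bdd_space_derivs K T k (D_eta g)"
    using g by auto
  have "\<bar>g t (\<xi> + h) (\<eta> + k') - g t (\<xi> + h) \<eta>\<bar> \<le> K * \<bar>k'\<bar>"
    by (rule taylor_order1[OF D_eta_has_derivative[OF sd t] bdd_space_derivs_bound[OF bd(2) t]])
  moreover have "\<bar>g t (\<xi> + h) \<eta> - g t \<xi> \<eta>\<bar> \<le> K * \<bar>h\<bar>"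
    by (rule taylor_order1[where g = "\<lambda>x. g t x \<eta>",
          OF D_xi_has_derivative[OF sd t] bdd_space_derivs_bound[OF bd(1) t]])
  ultimately show ?thesis by (simp add: algebra_simps)
qed

lemma time_lipschitz:
  assumes "t_differentiable T g" and "\<And>s \<xi> \<eta>. s < T \<Longrightarrow> \<bar>D_t g s \<xi> \<eta>\<bar> \<le> K"
    and "t \<le> s" "s < T"
  shows "\<bar>g s \<xi> \<eta> - g t \<xi> \<eta>\<bar> \<le> K * (s - t)"
proof -
  have "((\<lambda>s. g s \<xi> \<eta>) has_real_derivative D_t g z \<xi> \<eta>) (at z within {t..s})" if "z \<in> {t..s}" for z
    using that assms(4) by (intro has_field_derivative_at_within[OF D_t_has_derivative[OF assms(1)]]) simp
  from field_differentiable_bound[OF _ this, of K s t] show ?thesis using assms(2-4) by simp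
qed

lemma taylor_time:
  assumes "t_differentiable T g" "t_differentiable T (D_t g)" "bdd_cont K T (D_t (D_t g))"
    and "t \<le> s" "s < T"
  shows "\<bar>g s \<xi> \<eta> - (g t \<xi> \<eta> + (s - t) * D_t g t \<xi> \<eta>)\<bar> \<le> K * (s - t)\<^sup>2"
proof (cases "t = s")
  case False
  with assms have "t < s" by simp
  from MVT2[OF this, of "\<lambda>s. g s \<xi> \<eta>" "\<lambda>s. D_t g s \<xi> \<eta>"]
  obtain z where z: "t < z" "z < s" "g s \<xi> \<eta> - g t \<xi> \<eta> = (s - t) * D_t g z \<xi> \<eta>"
    using D_t_has_derivative[OF assms(1)] assms(5) by force
  have K: "0 \<le> K" using bdd_contD[OF assms(3,5), of \<xi> \<eta>] by linarith
  have "\<bar>D_t g z \<xi> \<eta> - D_t g t \<xi> \<eta>\<bar> \<le> K * (z - t)"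
    using time_lipschitz[OF assms(2) bdd_contD[OF assms(3)], of t z \<xi> \<eta>] z assms(5) by simp
  also have "\<dots> \<le> K * (s - t)" using K z by (intro mult_left_mono) auto
  finally have "(s - t) * \<bar>D_t g z \<xi> \<eta> - D_t g t \<xi> \<eta>\<bar> \<le> (s - t) * (K * (s - t))"
    using z by (intro mult_left_mono) auto
  moreover have "g s \<xi> \<eta> - (g t \<xi> \<eta> + (s - t) * D_t g t \<xi> \<eta>)
      = (s - t) * (D_t g z \<xi> \<eta> - D_t g t \<xi> \<eta>)"
    using z(3) by (simp add: right_diff_distrib)
  ultimately show ?thesis
    using \<open>t < s\<close> by (simp only: abs_mult power2_eq_square mult.left_commute[of K])
qed simp

text \<open>The Hessian contains both mixed derivatives. Expanding first in one order of the variables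
  and then in the other gives one mixed derivative each; the average of the two expansions has
  the symmetric second-order term.\<close>

lemma taylor_space:
  assumes sd: "space_differentiable T u"
    and dxi: "bdd_space_derivs K T 3 (D_xi u)" and deta: "bdd_space_derivs K T 3 (D_eta u)"
    and t: "t < T"
  shows "\<bar>u t (\<xi> + h) (\<eta> + k) - (u t \<xi> \<eta> + h * D_xi u t \<xi> \<eta> + k * D_eta u t \<xi> \<eta>
      + (h\<^sup>2 * D_xi (D_xi u) t \<xi> \<eta> + h * k * (D_xi (D_eta u) t \<xi> \<eta> + D_eta (D_xi u) t \<xi> \<eta>)
         + k\<^sup>2 * D_eta (D_eta u) t \<xi> \<eta>) / 2)\<bar> \<le> K * (\<bar>h\<bar> + \<bar>k\<bar>) ^ 3 / 6"
proof -
  note d = dxi[unfolded numeral_3_eq_3 bdd_space_derivs.simps]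
    deta[unfolded numeral_3_eq_3 bdd_space_derivs.simps]
  have differentiable: "space_differentiable T (D_xi u)" "space_differentiable T (D_eta u)"
    "space_differentiable T (D_xi (D_xi u))" "space_differentiable T (D_eta (D_xi u))"
    "space_differentiable T (D_xi (D_eta u))" "space_differentiable T (D_eta (D_eta u))"
    using d by blast+
  note derivs = differentiable[THEN D_xi_has_derivative, OF t] D_xi_has_derivative[OF sd t]
    differentiable[THEN D_eta_has_derivative, OF t] D_eta_has_derivative[OF sd t]
  have third: "bdd_cont K T (D_xi (D_xi (D_xi u)))" "bdd_cont K T (D_eta (D_eta (D_eta u)))"
    "bdd_cont K T (D_xi (D_xi (D_eta u)))" "bdd_cont K T (D_xi (D_eta (D_eta u)))"
    "bdd_cont K T (D_eta (D_eta (D_xi u)))" "bdd_cont K T (D_eta (D_xi (D_xi u)))"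
    using d by blast+
  note bounds = third[THEN bdd_contD, OF t]
  define XX where "XX = u t \<xi> \<eta> + h * D_xi u t \<xi> \<eta> + k * D_eta u t \<xi> \<eta>
      + h\<^sup>2 / 2 * D_xi (D_xi u) t \<xi> \<eta> + h * k * D_xi (D_eta u) t \<xi> \<eta>
      + k\<^sup>2 / 2 * D_eta (D_eta u) t \<xi> \<eta>"
  have X: "\<bar>u t (\<xi> + h) (\<eta> + k) - XX\<bar> \<le> K * (\<bar>h\<bar> + \<bar>k\<bar>) ^ 3 / 6"
    unfolding XX_def by (rule taylor_two_variables_iterated[where g = "u t"
        and ?g1.0 = "(D_xi u) t"
        and ?g11.0 = "(D_xi (D_xi u)) t"
        and ?g111.0 = "(D_xi (D_xi (D_xi u))) t"
        and ?g2.0 = "(D_eta u) t"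
        and ?g22.0 = "(D_eta (D_eta u)) t"
        and ?g222.0 = "(D_eta (D_eta (D_eta u))) t"
        and ?g21.0 = "(D_xi (D_eta u)) t"
        and ?g211.0 = "(D_xi (D_xi (D_eta u))) t"
        and ?g221.0 = "(D_xi (D_eta (D_eta u))) t"]; rule derivs bounds)
  define YY where "YY = u t \<xi> \<eta> + k * D_eta u t \<xi> \<eta> + h * D_xi u t \<xi> \<eta>
      + k\<^sup>2 / 2 * D_eta (D_eta u) t \<xi> \<eta> + k * h * D_eta (D_xi u) t \<xi> \<eta>
      + h\<^sup>2 / 2 * D_xi (D_xi u) t \<xi> \<eta>"
  have Y: "\<bar>u t (\<xi> + h) (\<eta> + k) - YY\<bar> \<le> K * (\<bar>k\<bar> + \<bar>h\<bar>) ^ 3 / 6"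
    unfolding YY_def by (rule taylor_two_variables_iterated[where g = "\<lambda>y x. u t x y"
        and ?g1.0 = "\<lambda>y x. (D_eta u) t x y"
        and ?g11.0 = "\<lambda>y x. (D_eta (D_eta u)) t x y"
        and ?g111.0 = "\<lambda>y x. (D_eta (D_eta (D_eta u))) t x y"
        and ?g2.0 = "\<lambda>y x. (D_xi u) t x y"
        and ?g22.0 = "\<lambda>y x. (D_xi (D_xi u)) t x y"
        and ?g222.0 = "\<lambda>y x. (D_xi (D_xi (D_xi u))) t x y"
        and ?g21.0 = "\<lambda>y x. (D_eta (D_xi u)) t x y"
        and ?g211.0 = "\<lambda>y x. (D_eta (D_eta (D_xi u))) t x y"
        and ?g221.0 = "\<lambda>y x. (D_eta (D_xi (D_xi u))) t x y"]; rule derivs bounds)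
  have "\<bar>z - (x + y) / 2\<bar> \<le> R" if "\<bar>z - x\<bar> \<le> R" "\<bar>z - y\<bar> \<le> R" for x y z R :: real
    using that by (simp add: abs_le_iff field_simps)
  from this[OF X Y[unfolded add.commute[of "\<bar>k\<bar>"]]]
  have average: "\<bar>u t (\<xi> + h) (\<eta> + k) - (XX + YY) / 2\<bar> \<le> K * (\<bar>h\<bar> + \<bar>k\<bar>) ^ 3 / 6" .
  have "(XX + YY) / 2 = u t \<xi> \<eta> + h * D_xi u t \<xi> \<eta> + k * D_eta u t \<xi> \<eta>
      + (h\<^sup>2 * D_xi (D_xi u) t \<xi> \<eta> + h * k * (D_xi (D_eta u) t \<xi> \<eta> + D_eta (D_xi u) t \<xi> \<eta>)
         + k\<^sup>2 * D_eta (D_eta u) t \<xi> \<eta>) / 2"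
    unfolding XX_def YY_def by (simp add: field_simps)
  with average show ?thesis by (simp only:)
qed


section \<open>Playing a given investment\<close>

text \<open>Continuity of \<open>w\<close> matters here: it bounds the worst-case values below, and the infimum of
  a set of reals without a lower bound has no specified value.\<close>

lemma dp_step_le_worst_case:
  assumes "\<And>m :: nat. continuous_on UNIV (\<lambda>(\<xi>, \<eta>). w m \<xi> \<eta>)" and "\<bar>f\<bar> \<le> 1"
  shows "dp_step q r \<epsilon> w m \<xi> \<eta> \<le> worst_case q r \<epsilon> w m \<xi> \<eta> f"
  using dp_step_attained[of w q r \<epsilon> m \<xi> \<eta>] assms by metis

lemma worst_case_le:
  assumes "\<And>b. b \<in> {-1, 1} \<Longrightarrow> w (next_state b) (\<xi> + \<epsilon> * b * (q m - r m))
      (\<eta> + \<epsilon> * b * (q m + r m - 2 * f)) \<le> B"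
  shows "worst_case q r \<epsilon> w m \<xi> \<eta> f \<le> B"
  using assms[of "-1"] assms[of 1] unfolding worst_case_def by simp


section \<open>The corrector and the investment rule\<close>

text \<open>The relative deviation of the squared expert difference at state \<open>m\<close> from its average over
  the two states; \<open>\<epsilon>\<^sup>2 * state_weight q r m * D_t u\<close> is the corrector added to \<open>u\<close>.\<close>

definition state_weight :: "(nat \<Rightarrow> real) \<Rightarrow> (nat \<Rightarrow> real) \<Rightarrow> nat \<Rightarrow> real" where
  "state_weight q r m = 1 - (q m - r m)\<^sup>2 / C_sharp_1 q r"

text \<open>As \<open>\<rho>\<close> bounds the experts, \<open>1 - \<rho>\<close> is the room that is left for the correction of order
  \<open>\<epsilon>\<close> to the investment rule.\<close>

locale final_value_solution =
  fixes q r :: "nat \<Rightarrow> real" and \<rho> K c T :: real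
    and \<phi> :: "real \<Rightarrow> real \<Rightarrow> real" and u :: "real \<Rightarrow> real \<Rightarrow> real \<Rightarrow> real"
  assumes experts: "m \<in> {0, 1} \<Longrightarrow> \<bar>q m\<bar> \<le> \<rho>" "m \<in> {0, 1} \<Longrightarrow> \<bar>r m\<bar> \<le> \<rho>" and \<rho>: "\<rho> < 1"
    and experts_differ: "\<exists>m\<in>{0, 1}. q m \<noteq> r m"
    and c_pos: "c > 0"
    and solution: "solves_final_value_problem (C_sharp_1 q r) T \<phi> u"
    and regular: "regular_solution K T u"
    and D_eta_gt: "t < T \<Longrightarrow> D_eta u t \<xi> \<eta> > c"
    and D_xi_le: "t < T \<Longrightarrow> \<bar>D_xi u t \<xi> \<eta>\<bar> \<le> D_eta u t \<xi> \<eta>"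
begin

abbreviation "\<kappa> \<equiv> state_weight q r"

lemma C_sharp_pos: "C_sharp_1 q r > 0"
proof -
  have "(q 0 - r 0)\<^sup>2 > 0 \<or> (q 1 - r 1)\<^sup>2 > 0" using experts_differ by auto
  then have "(q 1 - r 1)\<^sup>2 + (q 0 - r 0)\<^sup>2 > 0"
    using zero_le_power2[of "q 0 - r 0"] zero_le_power2[of "q 1 - r 1"] by linarith
  then show ?thesis unfolding C_sharp_1_def by simp
qed

lemma state_weight_0: "\<kappa> 0 = ((q 1 - r 1)\<^sup>2 - (q 0 - r 0)\<^sup>2) / (2 * C_sharp_1 q r)"
  and state_weight_1: "\<kappa> 1 = ((q 0 - r 0)\<^sup>2 - (q 1 - r 1)\<^sup>2) / (2 * C_sharp_1 q r)"
proof -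
  have weight: "1 - y / C = (x - y) / (2 * C)" if "2 * C = x + y" "C > 0" for x y C :: real
  proof -
    have "x = 2 * C - y" using that(1) by simp
    then show ?thesis using that(2) by (simp add: diff_divide_distrib)
  qed
  show "\<kappa> 0 = ((q 1 - r 1)\<^sup>2 - (q 0 - r 0)\<^sup>2) / (2 * C_sharp_1 q r)"
    "\<kappa> 1 = ((q 0 - r 0)\<^sup>2 - (q 1 - r 1)\<^sup>2) / (2 * C_sharp_1 q r)"
    unfolding state_weight_def
    by (rule weight[OF _ C_sharp_pos]; simp add: C_sharp_1_def)+
qed

text \<open>The market move \<open>b\<close> determines the next state, so the next value of the corrector has the
  form \<open>b * const\<close>. Only terms of this form can be cancelled by a change of \<open>f\<close>, since \<open>f\<close> enters
  the displacement multiplied by \<open>b\<close>.\<close>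

lemma state_weight_next: "b \<in> {-1, 1} \<Longrightarrow> \<kappa> (next_state b) = b * \<kappa> 1"
  using state_weight_0 state_weight_1 unfolding next_state_def
  by (auto simp: diff_divide_distrib)

lemma state_weight_abs:
  assumes "m \<in> {0, 1}"
  shows "\<bar>\<kappa> m\<bar> \<le> 1"
proof -
  have ratio: "\<bar>(x - y) / (2 * C)\<bar> \<le> 1" if "0 \<le> x" "0 \<le> y" "2 * C = x + y" "C > 0"
    for x y C :: real
    using that by (simp add: abs_le_iff)
  have "\<bar>\<kappa> 0\<bar> \<le> 1" "\<bar>\<kappa> 1\<bar> \<le> 1" unfolding state_weight_0 state_weight_1
    by (rule ratio[OF _ _ _ C_sharp_pos]; simp add: C_sharp_1_def)+
  with assms show ?thesis by auto
qed

lemma regularity: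
  "continuous_on ({..T} \<times> UNIV) (\<lambda>(t, \<xi>, \<eta>). u t \<xi> \<eta>)" "space_differentiable T u"
  "bdd_space_derivs K T 3 (D_xi u)" "bdd_space_derivs K T 3 (D_eta u)"
  "t_differentiable T u" "bdd_space_derivs K T (Suc 1) (D_t u)"
  "t_differentiable T (D_t u)" "bdd_cont K T (D_t (D_t u))"
  using regular unfolding regular_solution_def by (simp_all add: numeral_2_eq_2)

lemma D_t_bound: "t < T \<Longrightarrow> \<bar>D_t u t \<xi> \<eta>\<bar> \<le> K"
  using bdd_space_derivs_bound[OF regularity(6)] .

lemma K_nonneg: "0 \<le> K"
  using D_t_bound[of "T - 1" 0 0] by linarith

lemma second_derivs_bound:
  assumes "t < T"
  shows "\<bar>D_xi (D_eta u) t \<xi> \<eta>\<bar> \<le> K" "\<bar>D_eta (D_xi u) t \<xi> \<eta>\<bar> \<le> K" "\<bar>D_eta (D_eta u) t \<xi> \<eta>\<bar> \<le> K"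
  using regularity(3,4) assms
  by (auto simp: numeral_3_eq_3 dest: bdd_contD)

lemma D_t_eq:
  assumes "t < T"
  shows "D_t u t \<xi> \<eta> = - (C_sharp_1 q r / 2) * (D_xi (D_xi u) t \<xi> \<eta>
     - (D_xi u t \<xi> \<eta> / D_eta u t \<xi> \<eta>) * (D_xi (D_eta u) t \<xi> \<eta> + D_eta (D_xi u) t \<xi> \<eta>)
     + (D_xi u t \<xi> \<eta> / D_eta u t \<xi> \<eta>)\<^sup>2 * D_eta (D_eta u) t \<xi> \<eta>)"
proof -
  define E where "E = D_eta u t \<xi> \<eta>"
  define w where "w = grad_perp u t \<xi> \<eta> /\<^sub>R E"
  have "E \<noteq> 0" using D_eta_gt[OF assms, of \<xi> \<eta>] c_pos unfolding E_def by simp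
  then have w: "w $ 1 = - 1" "w $ 2 = D_xi u t \<xi> \<eta> / E"
    unfolding w_def grad_perp_def E_def by (simp_all add: field_simps)
  have "(hessian u t \<xi> \<eta> *v w) \<bullet> w = D_xi (D_xi u) t \<xi> \<eta>
     - (D_xi u t \<xi> \<eta> / E) * (D_xi (D_eta u) t \<xi> \<eta> + D_eta (D_xi u) t \<xi> \<eta>)
     + (D_xi u t \<xi> \<eta> / E)\<^sup>2 * D_eta (D_eta u) t \<xi> \<eta>"
    unfolding hessian_def matrix_vector_mult_def inner_vec_def
    by (simp add: sum_2 w algebra_simps power2_eq_square)
  moreover have "D_t u t \<xi> \<eta> + 1 / 2 * C_sharp_1 q r * ((hessian u t \<xi> \<eta> *v w) \<bullet> w) = 0"
    using solution assms unfolding solves_final_value_problem_def Let_def w_def E_def by blast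
  ultimately show ?thesis unfolding E_def by simp
qed

text \<open>The investment rule. Its main part makes the displacement tangent to the level line of \<open>u\<close>.
  Its part of order \<open>\<epsilon>\<close> produces the term \<open>- b * \<kappa> 1\<close>, which the corrector at the next state
  cancels; the equation turns the second-order term \<open>a\<^sup>2 Q / 2\<close> into
  \<open>(\<kappa> m - 1) * D_t u t \<xi> \<eta>\<close>. The smallness of \<open>\<epsilon>\<close> keeps \<open>f\<close> admissible.\<close>

lemma control_expansion:
  assumes t: "t < T" and m: "m \<in> {0, 1}" and \<epsilon>: "0 < \<epsilon>" and small: "\<epsilon> * K \<le> 2 * c * (1 - \<rho>)"
  obtains f where "\<bar>f\<bar> \<le> 1" and
    "\<And>b. b \<in> {-1, 1} \<Longrightarrow>
      \<bar>u t (\<xi> + \<epsilon> * b * (q m - r m)) (\<eta> + \<epsilon> * b * (q m + r m - 2 * f))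
        - (u t \<xi> \<eta> + \<epsilon>\<^sup>2 * (\<kappa> m - 1 - b * \<kappa> 1) * D_t u t \<xi> \<eta>)\<bar>
      \<le> (36 * K + 5 * K\<^sup>2 / c) * \<epsilon> ^ 3"
proof -
  define a where "a = q m - r m"
  define P where "P = D_xi u t \<xi> \<eta>"
  define E where "E = D_eta u t \<xi> \<eta>"
  define U where "U = D_t u t \<xi> \<eta>"
  define Uxx where "Uxx = D_xi (D_xi u) t \<xi> \<eta>"
  define M where "M = D_xi (D_eta u) t \<xi> \<eta> + D_eta (D_xi u) t \<xi> \<eta>"
  define Uyy where "Uyy = D_eta (D_eta u) t \<xi> \<eta>"
  define p where "p = P / E"
  define \<theta> where "\<theta> = \<kappa> 1 * U / (2 * E)"
  define f where "f = (q m + r m + a * p) / 2 + \<epsilon> * \<theta>"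
  define \<beta> where "\<beta> = q m + r m - 2 * f"
  have E: "E > c" "E > 0" using D_eta_gt[OF t, of \<xi> \<eta>] c_pos unfolding E_def by auto
  have pE: "p * E = P" and \<theta>E: "2 * \<theta> * E = \<kappa> 1 * U"
    using E unfolding p_def \<theta>_def by auto
  have p: "\<bar>p\<bar> \<le> 1" using D_xi_le[OF t, of \<xi> \<eta>] E unfolding p_def P_def E_def by simp
  have qr: "\<bar>q m\<bar> \<le> \<rho>" "\<bar>r m\<bar> \<le> \<rho>" using experts m by auto
  have a: "\<bar>a\<bar> \<le> 2" using qr \<rho> unfolding a_def by linarith
  have U: "\<bar>\<kappa> 1 * U\<bar> \<le> K"
    using mult_mono[OF state_weight_abs[of 1] D_t_bound[OF t, of \<xi> \<eta>]] unfolding U_def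
    by (simp add: abs_mult)
  have "\<bar>\<theta>\<bar> = \<bar>\<kappa> 1 * U\<bar> / (2 * E)" unfolding \<theta>_def using E by (simp add: abs_mult)
  also have "\<dots> \<le> K / (2 * c)" using U E c_pos K_nonneg by (intro frac_le) auto
  finally have \<theta>: "\<bar>\<theta>\<bar> \<le> K / (2 * c)" .
  have f: "\<bar>f\<bar> \<le> 1"
  proof -
    \<comment> \<open>As \<open>\<bar>p\<bar> \<le> 1\<close>, the main part is a convex combination of the experts.\<close>
    have "\<bar>(q m + r m + a * p) / 2\<bar> = \<bar>q m * ((1 + p) / 2) + r m * ((1 - p) / 2)\<bar>"
      unfolding a_def by (rule arg_cong[where f = abs]) (simp add: field_simps)
    also have "\<dots> \<le> \<bar>q m\<bar> * ((1 + p) / 2) + \<bar>r m\<bar> * ((1 - p) / 2)"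
      using p abs_triangle_ineq[of "q m * ((1 + p) / 2)" "r m * ((1 - p) / 2)"]
      by (simp add: abs_mult)
    also have "\<dots> \<le> \<rho> * ((1 + p) / 2) + \<rho> * ((1 - p) / 2)"
      using p qr by (intro add_mono mult_right_mono) auto
    also have "\<dots> = \<rho>" by (simp add: field_simps)
    finally have 1: "\<bar>(q m + r m + a * p) / 2\<bar> \<le> \<rho>" .
    have "\<bar>\<epsilon> * \<theta>\<bar> = \<epsilon> * \<bar>\<theta>\<bar>" using \<epsilon> by (simp add: abs_mult)
    also have "\<dots> \<le> \<epsilon> * (K / (2 * c))" using \<theta> \<epsilon> by (intro mult_left_mono) auto
    also have "\<dots> \<le> 1 - \<rho>" using small c_pos by (simp add: field_simps)
    finally show ?thesis using 1 unfolding f_def by linarith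
  qed
  have \<beta>: "\<bar>\<beta>\<bar> \<le> 4" using f qr \<rho> unfolding \<beta>_def by linarith
  have \<beta>_eq: "\<beta> = - a * p - 2 * \<epsilon> * \<theta>" unfolding \<beta>_def f_def by (simp add: field_simps)
  define Q where "Q = Uxx - p * M + p\<^sup>2 * Uyy"
  have UQ: "U = - (C_sharp_1 q r / 2) * Q"
    using D_t_eq[OF t, of \<xi> \<eta>]
    unfolding U_def Q_def p_def P_def E_def Uxx_def M_def Uyy_def .
  have aQ: "a\<^sup>2 * Q = 2 * (\<kappa> m - 1) * U"
    using C_sharp_pos unfolding UQ state_weight_def a_def by simp
  \<comment> \<open>The quadratic form of the Hessian at \<open>(a, \<beta>)\<close> exceeds its value at the tangent
    direction \<open>(a, - a * p)\<close> by \<open>(\<beta> + a * p) * S\<close>, where \<open>\<beta> + a * p = - 2 * \<epsilon> * \<theta>\<close> is small.\<close>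
  define S where "S = a * M + (\<beta> - a * p) * Uyy"
  have S: "\<bar>S\<bar> \<le> 10 * K"
  proof -
    have "\<bar>M\<bar> \<le> 2 * K" "\<bar>Uyy\<bar> \<le> K"
      using second_derivs_bound[OF t, of \<xi> \<eta>] unfolding M_def Uyy_def by linarith+
    moreover have "\<bar>a * p\<bar> \<le> 2" using mult_mono[OF a p] by (simp add: abs_mult)
    then have "\<bar>\<beta> - a * p\<bar> \<le> 6" using \<beta> by linarith
    ultimately have "\<bar>a * M\<bar> \<le> 2 * (2 * K)" "\<bar>(\<beta> - a * p) * Uyy\<bar> \<le> 6 * K"
      unfolding abs_mult using a by - (rule mult_mono; simp)+
    then show ?thesis unfolding S_def by linarith
  qed
  have \<theta>S: "\<bar>\<epsilon> ^ 3 * (\<theta> * S)\<bar> \<le> 5 * K\<^sup>2 / c * \<epsilon> ^ 3"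
  proof -
    have "\<bar>\<theta> * S\<bar> \<le> K / (2 * c) * (10 * K)"
      unfolding abs_mult using \<theta> S K_nonneg c_pos by (intro mult_mono) auto
    also have "\<dots> = 5 * K\<^sup>2 / c" by (simp add: power2_eq_square)
    finally have "\<epsilon> ^ 3 * \<bar>\<theta> * S\<bar> \<le> \<epsilon> ^ 3 * (5 * K\<^sup>2 / c)"
      using \<epsilon> by (intro mult_left_mono) auto
    then show ?thesis using \<epsilon> by (simp add: abs_mult mult_ac)
  qed
  have "\<bar>u t (\<xi> + \<epsilon> * b * a) (\<eta> + \<epsilon> * b * \<beta>)
        - (u t \<xi> \<eta> + \<epsilon>\<^sup>2 * (\<kappa> m - 1 - b * \<kappa> 1) * U)\<bar> \<le> (36 * K + 5 * K\<^sup>2 / c) * \<epsilon> ^ 3"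
    if b: "b \<in> {-1, 1}" for b
  proof -
    have bb: "b * b = 1" "\<bar>b\<bar> = 1" using b by auto
    \<comment> \<open>This bound on the displacement makes the Taylor remainder at most
      \<open>K * (6 * \<epsilon>) ^ 3 / 6 = 36 * K * \<epsilon> ^ 3\<close>.\<close>
    have "\<bar>\<epsilon> * b * a\<bar> + \<bar>\<epsilon> * b * \<beta>\<bar> \<le> 6 * \<epsilon>"
      using a \<beta> \<epsilon> bb mult_left_mono[of "\<bar>a\<bar> + \<bar>\<beta>\<bar>" 6 \<epsilon>] by (simp add: abs_mult algebra_simps)
    then have "(\<bar>\<epsilon> * b * a\<bar> + \<bar>\<epsilon> * b * \<beta>\<bar>) ^ 3 \<le> (6 * \<epsilon>) ^ 3"
      by (intro power_mono) auto
    from mult_left_mono[OF this K_nonneg]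
    have "K * (\<bar>\<epsilon> * b * a\<bar> + \<bar>\<epsilon> * b * \<beta>\<bar>) ^ 3 / 6 \<le> 36 * K * \<epsilon> ^ 3"
      by (simp add: power_mult_distrib)
    with taylor_space[OF regularity(2-4) t, of \<xi> "\<epsilon> * b * a" \<eta> "\<epsilon> * b * \<beta>"]
    have "\<bar>u t (\<xi> + \<epsilon> * b * a) (\<eta> + \<epsilon> * b * \<beta>)
        - (u t \<xi> \<eta> + (\<epsilon> * b * a) * P + (\<epsilon> * b * \<beta>) * E + ((\<epsilon> * b * a)\<^sup>2 * Uxx
           + (\<epsilon> * b * a) * (\<epsilon> * b * \<beta>) * M + (\<epsilon> * b * \<beta>)\<^sup>2 * Uyy) / 2)\<bar> \<le> 36 * K * \<epsilon> ^ 3"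
      unfolding P_def E_def Uxx_def M_def Uyy_def by linarith
    moreover have "(\<epsilon> * b * a) * P + (\<epsilon> * b * \<beta>) * E = - \<epsilon>\<^sup>2 * b * \<kappa> 1 * U"
    proof -
      have "(\<epsilon> * b * a) * P + (\<epsilon> * b * \<beta>) * E = \<epsilon> * b * a * (P - p * E) - \<epsilon>\<^sup>2 * b * (2 * \<theta> * E)"
        unfolding \<beta>_eq by (simp add: algebra_simps power2_eq_square)
      then show ?thesis unfolding \<theta>E pE by simp
    qed
    moreover have "((\<epsilon> * b * a)\<^sup>2 * Uxx + (\<epsilon> * b * a) * (\<epsilon> * b * \<beta>) * M
        + (\<epsilon> * b * \<beta>)\<^sup>2 * Uyy) / 2 = \<epsilon>\<^sup>2 * (\<kappa> m - 1) * U - \<epsilon> ^ 3 * (\<theta> * S)"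
    proof -
      have "(\<epsilon> * b * a)\<^sup>2 * Uxx + (\<epsilon> * b * a) * (\<epsilon> * b * \<beta>) * M + (\<epsilon> * b * \<beta>)\<^sup>2 * Uyy
          = \<epsilon>\<^sup>2 * (b * b) * (a\<^sup>2 * Uxx + a * \<beta> * M + \<beta>\<^sup>2 * Uyy)"
        by (simp add: algebra_simps power2_eq_square)
      also have "a\<^sup>2 * Uxx + a * \<beta> * M + \<beta>\<^sup>2 * Uyy = a\<^sup>2 * Q + (\<beta> + a * p) * S"
        unfolding Q_def S_def by (simp add: algebra_simps power2_eq_square)
      also have "\<beta> + a * p = - 2 * \<epsilon> * \<theta>" unfolding \<beta>_eq by simp
      finally show ?thesis unfolding bb aQ
        by (simp only:) (simp add: field_simps power2_eq_square power3_eq_cube)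
    qed
    ultimately show ?thesis using \<theta>S by (simp add: algebra_simps)
  qed
  from that[OF f this[unfolded a_def \<beta>_def U_def]] show thesis by simp
qed


section \<open>One step of the dynamic programming principle\<close>

text \<open>The displacement is at most \<open>2 * \<epsilon>\<close> in \<open>\<xi>\<close> and at most \<open>4 * \<epsilon>\<close> in \<open>\<eta>\<close>, because the
  experts and \<open>f\<close> lie between \<open>-1\<close> and \<open>1\<close>.\<close>

lemma step_size:
  assumes "m \<in> {0, 1}" "\<bar>f\<bar> \<le> 1" "b \<in> {-1, 1}" "0 < \<epsilon>"
  shows "\<bar>\<epsilon> * b * (q m - r m)\<bar> + \<bar>\<epsilon> * b * (q m + r m - 2 * f)\<bar> \<le> 6 * \<epsilon>"
proof -
  have "\<bar>q m - r m\<bar> + \<bar>q m + r m - 2 * f\<bar> \<le> 6"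
    using experts[OF assms(1)] \<rho> assms(2) by linarith
  moreover have "\<bar>\<epsilon> * b * x\<bar> = \<epsilon> * \<bar>x\<bar>" for x
    using assms(3,4) by (auto simp: abs_mult)
  ultimately show ?thesis using assms(4) mult_left_mono[of _ 6 \<epsilon>] by (simp flip: distrib_left)
qed

text \<open>The corrected function \<open>u + \<epsilon>\<^sup>2 * \<kappa> m * D_t u\<close> is a supersolution of the dynamic programming
  principle up to \<open>O(\<epsilon>\<^sup>3)\<close>. Moving \<open>u\<close> forward in time adds \<open>\<epsilon>\<^sup>2 * D_t u\<close>, which absorbs the \<open>- 1\<close>
  of \<open>control_expansion\<close>; replacing \<open>D_t u\<close> at the new time and position by its value at the old
  ones costs \<open>O(\<epsilon>\<^sup>3)\<close>.\<close>

lemma interior_step: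
  assumes t: "t + \<epsilon>\<^sup>2 < T" and m: "m \<in> {0, 1}" and \<epsilon>: "0 < \<epsilon>" "\<epsilon> \<le> 1"
    and small: "\<epsilon> * K \<le> 2 * c * (1 - \<rho>)"
  obtains f where "\<bar>f\<bar> \<le> 1" and
    "\<And>b \<xi>' \<eta>'. b \<in> {-1, 1} \<Longrightarrow> \<xi>' = \<xi> + \<epsilon> * b * (q m - r m) \<Longrightarrow>
        \<eta>' = \<eta> + \<epsilon> * b * (q m + r m - 2 * f) \<Longrightarrow>
      u (t + \<epsilon>\<^sup>2) \<xi>' \<eta>' + \<epsilon>\<^sup>2 * \<kappa> (next_state b) * D_t u (t + \<epsilon>\<^sup>2) \<xi>' \<eta>'
        \<le> u t \<xi> \<eta> + \<epsilon>\<^sup>2 * \<kappa> m * D_t u t \<xi> \<eta> + (50 * K + 5 * K\<^sup>2 / c) * \<epsilon> ^ 3"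
proof -
  have tT: "t < T" using t zero_le_power2[of \<epsilon>] by linarith
  obtain f where f: "\<bar>f\<bar> \<le> 1" and exp: "\<And>b. b \<in> {-1, 1} \<Longrightarrow>
      \<bar>u t (\<xi> + \<epsilon> * b * (q m - r m)) (\<eta> + \<epsilon> * b * (q m + r m - 2 * f))
        - (u t \<xi> \<eta> + \<epsilon>\<^sup>2 * (\<kappa> m - 1 - b * \<kappa> 1) * D_t u t \<xi> \<eta>)\<bar>
      \<le> (36 * K + 5 * K\<^sup>2 / c) * \<epsilon> ^ 3"
    using control_expansion[OF tT m \<epsilon>(1) small] by blast
  have "u (t + \<epsilon>\<^sup>2) \<xi>' \<eta>' + \<epsilon>\<^sup>2 * \<kappa> (next_state b) * D_t u (t + \<epsilon>\<^sup>2) \<xi>' \<eta>'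
        \<le> u t \<xi> \<eta> + \<epsilon>\<^sup>2 * \<kappa> m * D_t u t \<xi> \<eta> + (50 * K + 5 * K\<^sup>2 / c) * \<epsilon> ^ 3"
    if b: "b \<in> {-1, 1}" and x: "\<xi>' = \<xi> + \<epsilon> * b * (q m - r m)"
      "\<eta>' = \<eta> + \<epsilon> * b * (q m + r m - 2 * f)" for b \<xi>' \<eta>'
  proof -
    define k where "k = \<kappa> (next_state b)"
    have k: "\<bar>k\<bar> \<le> 1" and kb: "b * \<kappa> 1 = k"
      using state_weight_abs[of "next_state b"] state_weight_next[OF b]
      unfolding k_def by (auto simp: next_state_def)
    have e3: "\<epsilon> ^ 4 \<le> \<epsilon> ^ 3" using \<epsilon> by (intro power_decreasing) auto
    have "\<bar>u (t + \<epsilon>\<^sup>2) \<xi>' \<eta>' - (u t \<xi>' \<eta>' + \<epsilon>\<^sup>2 * D_t u t \<xi>' \<eta>')\<bar> \<le> K * \<epsilon> ^ 4"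
      using taylor_time[OF regularity(5,7,8), of t "t + \<epsilon>\<^sup>2" \<xi>' \<eta>'] t by simp
    also have "\<dots> \<le> K * \<epsilon> ^ 3" using e3 K_nonneg by (rule mult_left_mono)
    finally have 1: "\<bar>u (t + \<epsilon>\<^sup>2) \<xi>' \<eta>' - (u t \<xi>' \<eta>' + \<epsilon>\<^sup>2 * D_t u t \<xi>' \<eta>')\<bar> \<le> K * \<epsilon> ^ 3" .
    have "\<bar>D_t u t \<xi>' \<eta>' - D_t u t \<xi> \<eta>\<bar> \<le> K * (6 * \<epsilon>)"
      using space_lipschitz[OF regularity(6) tT, of \<xi> "\<epsilon> * b * (q m - r m)" \<eta>
          "\<epsilon> * b * (q m + r m - 2 * f)"] mult_left_mono[OF step_size[OF m f b \<epsilon>(1)] K_nonneg]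
      unfolding x by linarith
    from mult_left_mono[OF this, of "\<epsilon>\<^sup>2"]
    have 2: "\<bar>\<epsilon>\<^sup>2 * (D_t u t \<xi>' \<eta>' - D_t u t \<xi> \<eta>)\<bar> \<le> 6 * K * \<epsilon> ^ 3"
      by (simp add: abs_mult power2_eq_square power3_eq_cube mult_ac)
    have "\<bar>D_t u (t + \<epsilon>\<^sup>2) \<xi>' \<eta>' - D_t u t \<xi>' \<eta>'\<bar> \<le> K * \<epsilon>\<^sup>2"
      using time_lipschitz[OF regularity(7) bdd_contD[OF regularity(8)], of t "t + \<epsilon>\<^sup>2" \<xi>' \<eta>'] t
      by simp
    from mult_left_mono[OF this, of "\<epsilon>\<^sup>2"]
    have "\<bar>\<epsilon>\<^sup>2 * (D_t u (t + \<epsilon>\<^sup>2) \<xi>' \<eta>' - D_t u t \<xi>' \<eta>')\<bar> \<le> K * \<epsilon> ^ 4"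
      by (simp add: abs_mult power2_eq_square eval_nat_numeral mult_ac)
    also have "\<dots> \<le> K * \<epsilon> ^ 3" using e3 K_nonneg by (rule mult_left_mono)
    finally have "\<bar>\<epsilon>\<^sup>2 * (D_t u (t + \<epsilon>\<^sup>2) \<xi>' \<eta>' - D_t u t \<xi> \<eta>)\<bar> \<le> 7 * K * \<epsilon> ^ 3"
      using 2 by (simp add: algebra_simps)
    from mult_mono[OF k this]
    have 3: "\<bar>\<epsilon>\<^sup>2 * k * (D_t u (t + \<epsilon>\<^sup>2) \<xi>' \<eta>' - D_t u t \<xi> \<eta>)\<bar> \<le> 7 * K * \<epsilon> ^ 3"
      by (simp add: abs_mult mult_ac)
    have 4: "\<bar>u t \<xi>' \<eta>' - (u t \<xi> \<eta> + \<epsilon>\<^sup>2 * (\<kappa> m - 1 - k) * D_t u t \<xi> \<eta>)\<bar>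
      \<le> (36 * K + 5 * K\<^sup>2 / c) * \<epsilon> ^ 3"
      using exp[OF b] unfolding x kb .
    show ?thesis using 1 2 3 4 unfolding k_def[symmetric]
      by (simp add: algebra_simps)
  qed
  with that f show thesis by blast
qed

text \<open>At time \<open>T\<close> neither the time derivative nor the corrector is available. Instead \<open>u\<close> at times
  \<open>s < T\<close> is compared with \<open>u\<close> at the start of the step, and continuity lets \<open>s\<close> tend to \<open>T\<close>. The
  error is \<open>O(\<epsilon>\<^sup>2)\<close>, which is affordable because this step occurs once.\<close>

lemma last_step:
  assumes m: "m \<in> {0, 1}" and \<epsilon>: "0 < \<epsilon>" "\<epsilon> \<le> 1" and small: "\<epsilon> * K \<le> 2 * c * (1 - \<rho>)"
    and t: "t = T - \<epsilon>\<^sup>2"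
  obtains f where "\<bar>f\<bar> \<le> 1" and
    "\<And>b. b \<in> {-1, 1} \<Longrightarrow>
      u T (\<xi> + \<epsilon> * b * (q m - r m)) (\<eta> + \<epsilon> * b * (q m + r m - 2 * f))
        \<le> u t \<xi> \<eta> + \<epsilon>\<^sup>2 * \<kappa> m * D_t u t \<xi> \<eta> + (39 * K + 5 * K\<^sup>2 / c) * \<epsilon>\<^sup>2"
proof -
  have tT: "t < T" using t \<epsilon> by simp
  obtain f where f: "\<bar>f\<bar> \<le> 1" and exp: "\<And>b. b \<in> {-1, 1} \<Longrightarrow>
      \<bar>u t (\<xi> + \<epsilon> * b * (q m - r m)) (\<eta> + \<epsilon> * b * (q m + r m - 2 * f))
        - (u t \<xi> \<eta> + \<epsilon>\<^sup>2 * (\<kappa> m - 1 - b * \<kappa> 1) * D_t u t \<xi> \<eta>)\<bar>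
      \<le> (36 * K + 5 * K\<^sup>2 / c) * \<epsilon> ^ 3"
    using control_expansion[OF tT m \<epsilon>(1) small] by blast
  have "u T \<xi>' \<eta>' \<le> u t \<xi> \<eta> + \<epsilon>\<^sup>2 * \<kappa> m * D_t u t \<xi> \<eta> + (39 * K + 5 * K\<^sup>2 / c) * \<epsilon>\<^sup>2"
    if b: "b \<in> {-1, 1}" and x: "\<xi>' = \<xi> + \<epsilon> * b * (q m - r m)"
      "\<eta>' = \<eta> + \<epsilon> * b * (q m + r m - 2 * f)" for b \<xi>' \<eta>'
  proof -
    have "continuous_on {..T} (\<lambda>s. u s \<xi>' \<eta>')"
      using continuous_on_compose2[OF regularity(1), of "{..T}" "\<lambda>s. (s, \<xi>', \<eta>')"]
      by (force intro!: continuous_intros)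
    then have "((\<lambda>s. u s \<xi>' \<eta>') \<longlongrightarrow> u T \<xi>' \<eta>') (at T within {..T})"
      by (simp add: continuous_on_def)
    then have lim: "((\<lambda>s. u s \<xi>' \<eta>') \<longlongrightarrow> u T \<xi>' \<eta>') (at_left T)"
      by (rule tendsto_within_subset) auto
    have "\<forall>\<^sub>F s in at_left T. u s \<xi>' \<eta>' \<le> u t \<xi>' \<eta>' + K * \<epsilon>\<^sup>2"
    proof (rule eventually_mono[OF eventually_at_left_real[OF tT]])
      fix s assume "s \<in> {t<..<T}"
      then have s: "t \<le> s" "s < T" "s - t \<le> \<epsilon>\<^sup>2" using t by auto
      show "u s \<xi>' \<eta>' \<le> u t \<xi>' \<eta>' + K * \<epsilon>\<^sup>2"
        using time_lipschitz[OF regularity(5) D_t_bound s(1,2), of \<xi>' \<eta>']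
          mult_left_mono[OF s(3) K_nonneg] by linarith
    qed
    from tendsto_upperbound[OF lim this]
    have 1: "u T \<xi>' \<eta>' \<le> u t \<xi>' \<eta>' + K * \<epsilon>\<^sup>2" by simp
    have 2: "\<bar>u t \<xi>' \<eta>' - (u t \<xi> \<eta> + \<epsilon>\<^sup>2 * (\<kappa> m - 1 - b * \<kappa> 1) * D_t u t \<xi> \<eta>)\<bar>
      \<le> (36 * K + 5 * K\<^sup>2 / c) * \<epsilon>\<^sup>2"
    proof -
      have "\<epsilon> ^ 3 \<le> \<epsilon>\<^sup>2" using \<epsilon> by (intro power_decreasing) auto
      then have "(36 * K + 5 * K\<^sup>2 / c) * \<epsilon> ^ 3 \<le> (36 * K + 5 * K\<^sup>2 / c) * \<epsilon>\<^sup>2"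
        using K_nonneg c_pos by (intro mult_left_mono) auto
      with exp[OF b] show ?thesis unfolding x by linarith
    qed
    have "\<bar>1 + b * \<kappa> 1\<bar> \<le> 2" using b state_weight_abs[of 1] by auto
    then have "\<bar>\<epsilon>\<^sup>2 * (1 + b * \<kappa> 1) * D_t u t \<xi> \<eta>\<bar> \<le> \<epsilon>\<^sup>2 * 2 * K"
      unfolding abs_mult using D_t_bound[OF tT] by (intro mult_mono) auto
    with 1 2 show ?thesis by (simp add: algebra_simps)
  qed
  with that f show thesis by blast
qed


section \<open>Induction over the number of steps\<close>

lemma continuous_value_iter: "continuous_on UNIV (\<lambda>(\<xi>, \<eta>). value_iter q r \<epsilon> \<phi> n m \<xi> \<eta>)"
proof (rule value_iter_continuous)
  have "\<phi> \<xi> \<eta> = u T \<xi> \<eta>" for \<xi> \<eta>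
    using solution by (simp add: solves_final_value_problem_def)
  then show "continuous_on UNIV (\<lambda>(\<xi>, \<eta>). \<phi> \<xi> \<eta>)"
    using continuous_on_compose2[OF regularity(1), of UNIV "Pair T"]
    by (force intro!: continuous_intros simp: case_prod_beta)
qed

text \<open>The induction starts with one step, since the corrected function is not controlled at the
  final time. That step, the last of the game, accounts for the error of order \<open>\<epsilon>\<^sup>2\<close>.\<close>

lemma value_iter_le:
  fixes \<epsilon> :: real
  assumes \<epsilon>: "0 < \<epsilon>" "\<epsilon> \<le> 1" and small: "\<epsilon> * K \<le> 2 * c * (1 - \<rho>)" and m: "m \<in> {0, 1}"
  shows "value_iter q r \<epsilon> \<phi> (Suc n) m \<xi> \<eta>
    \<le> u (T - Suc n * \<epsilon>\<^sup>2) \<xi> \<eta> + \<epsilon>\<^sup>2 * \<kappa> m * D_t u (T - Suc n * \<epsilon>\<^sup>2) \<xi> \<eta>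
      + (39 * K + 5 * K\<^sup>2 / c) * \<epsilon>\<^sup>2 + n * ((50 * K + 5 * K\<^sup>2 / c) * \<epsilon> ^ 3)"
  using m
proof (induction n arbitrary: m \<xi> \<eta>)
  case 0
  obtain f where f: "\<bar>f\<bar> \<le> 1" and step: "\<And>b. b \<in> {-1, 1} \<Longrightarrow>
      u T (\<xi> + \<epsilon> * b * (q m - r m)) (\<eta> + \<epsilon> * b * (q m + r m - 2 * f))
        \<le> u (T - \<epsilon>\<^sup>2) \<xi> \<eta> + \<epsilon>\<^sup>2 * \<kappa> m * D_t u (T - \<epsilon>\<^sup>2) \<xi> \<eta> + (39 * K + 5 * K\<^sup>2 / c) * \<epsilon>\<^sup>2"
    using last_step[OF 0 \<epsilon> small refl] by blast
  have \<phi>: "\<phi> = u T"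
    using solution unfolding solves_final_value_problem_def by (intro ext) simp
  have "value_iter q r \<epsilon> \<phi> (Suc 0) m \<xi> \<eta>
      \<le> worst_case q r \<epsilon> (value_iter q r \<epsilon> \<phi> 0) m \<xi> \<eta> f"
    using dp_step_le_worst_case[of "value_iter q r \<epsilon> \<phi> 0", OF continuous_value_iter f] by simp
  also have "\<dots> \<le> u (T - \<epsilon>\<^sup>2) \<xi> \<eta> + \<epsilon>\<^sup>2 * \<kappa> m * D_t u (T - \<epsilon>\<^sup>2) \<xi> \<eta> + (39 * K + 5 * K\<^sup>2 / c) * \<epsilon>\<^sup>2"
    using step unfolding value_iter.simps(1) \<phi> by (rule worst_case_le)
  finally show ?case by simp
next
  case (Suc n)
  define t where "t = T - Suc (Suc n) * \<epsilon>\<^sup>2"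
  have t_next: "t + \<epsilon>\<^sup>2 = T - Suc n * \<epsilon>\<^sup>2" unfolding t_def by (simp add: algebra_simps)
  have "t + \<epsilon>\<^sup>2 < T" unfolding t_next using \<epsilon> by simp
  from interior_step[OF this Suc.prems \<epsilon> small, of \<xi> \<eta>]
  obtain f where f: "\<bar>f\<bar> \<le> 1" and step: "\<And>b \<xi>' \<eta>'. b \<in> {-1, 1} \<Longrightarrow>
        \<xi>' = \<xi> + \<epsilon> * b * (q m - r m) \<Longrightarrow> \<eta>' = \<eta> + \<epsilon> * b * (q m + r m - 2 * f) \<Longrightarrow>
      u (t + \<epsilon>\<^sup>2) \<xi>' \<eta>' + \<epsilon>\<^sup>2 * \<kappa> (next_state b) * D_t u (t + \<epsilon>\<^sup>2) \<xi>' \<eta>'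
        \<le> u t \<xi> \<eta> + \<epsilon>\<^sup>2 * \<kappa> m * D_t u t \<xi> \<eta> + (50 * K + 5 * K\<^sup>2 / c) * \<epsilon> ^ 3"
    by blast
  have "value_iter q r \<epsilon> \<phi> (Suc n) (next_state b)
        (\<xi> + \<epsilon> * b * (q m - r m)) (\<eta> + \<epsilon> * b * (q m + r m - 2 * f))
      \<le> u t \<xi> \<eta> + \<epsilon>\<^sup>2 * \<kappa> m * D_t u t \<xi> \<eta> + (39 * K + 5 * K\<^sup>2 / c) * \<epsilon>\<^sup>2
        + Suc n * ((50 * K + 5 * K\<^sup>2 / c) * \<epsilon> ^ 3)" if b: "b \<in> {-1, 1}" for b
  proof -
    have "next_state b \<in> {0, 1}" by (simp add: next_state_def)
    have combine: "v \<le> g + A + Suc n * X" if "v \<le> w + A + n * X" "w \<le> g + X"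
      for v w g A X :: real
      using that by (simp add: algebra_simps)
    show ?thesis
      by (rule combine[OF Suc.IH[OF \<open>next_state b \<in> {0, 1}\<close>, folded t_next] step[OF b refl refl]])
  qed
  then have worst: "worst_case q r \<epsilon> (value_iter q r \<epsilon> \<phi> (Suc n)) m \<xi> \<eta> f
      \<le> u t \<xi> \<eta> + \<epsilon>\<^sup>2 * \<kappa> m * D_t u t \<xi> \<eta> + (39 * K + 5 * K\<^sup>2 / c) * \<epsilon>\<^sup>2
        + Suc n * ((50 * K + 5 * K\<^sup>2 / c) * \<epsilon> ^ 3)"
    by (rule worst_case_le)
  show ?case unfolding t_def[symmetric] value_iter.simps(2)[of _ _ _ _ "Suc n"]
    by (rule order_trans[OF dp_step_le_worst_case[OF continuous_value_iter f] worst])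
qed

lemma scaled_value_le:
  assumes \<epsilon>: "0 < \<epsilon>" "\<epsilon> \<le> 1" and small: "\<epsilon> * K \<le> 2 * c * (1 - \<rho>)"
    and m: "m \<in> {0, 1}" and t: "t < T" "(T - t) / \<epsilon>\<^sup>2 \<in> \<nat>"
  shows "scaled_value q r T \<phi> \<epsilon> t m \<xi> \<eta>
    \<le> u t \<xi> \<eta> + (50 * K + 5 * K\<^sup>2 / c) * ((T - t) + \<epsilon>) * \<epsilon>"
proof -
  define B where "B = 50 * K + 5 * K\<^sup>2 / c"
  have B: "0 \<le> B" "40 * K + 5 * K\<^sup>2 / c \<le> B" unfolding B_def using K_nonneg c_pos by auto
  obtain k where k: "(T - t) / \<epsilon>\<^sup>2 = real k" using t(2) by (auto elim: Nats_cases)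
  with t(1) \<epsilon> have "k \<noteq> 0" by (intro notI) simp
  then obtain n where n: "k = Suc n" using not0_implies_Suc by blast
  have T: "T - t = Suc n * \<epsilon>\<^sup>2" using k n \<epsilon> by (simp add: field_simps)
  then have t_eq: "T - Suc n * \<epsilon>\<^sup>2 = t" by simp
  have "nat \<lfloor>(T - t) / \<epsilon>\<^sup>2\<rfloor> = Suc n"
    unfolding k n by (simp only: floor_of_nat nat_int)
  then have "scaled_value q r T \<phi> \<epsilon> t m \<xi> \<eta> = value_iter q r \<epsilon> \<phi> (Suc n) m \<xi> \<eta>"
    unfolding scaled_value_def by simp
  also have "\<dots> \<le> u t \<xi> \<eta> + \<epsilon>\<^sup>2 * \<kappa> m * D_t u t \<xi> \<eta>
      + (39 * K + 5 * K\<^sup>2 / c) * \<epsilon>\<^sup>2 + n * (B * \<epsilon> ^ 3)"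
    using value_iter_le[OF \<epsilon> small m, of n \<xi> \<eta>] unfolding t_eq B_def .
  also have "\<dots> \<le> u t \<xi> \<eta> + B * \<epsilon>\<^sup>2 + B * (T - t) * \<epsilon>"
  proof -
    have "\<bar>\<epsilon>\<^sup>2 * \<kappa> m * D_t u t \<xi> \<eta>\<bar> \<le> \<epsilon>\<^sup>2 * 1 * K"
      unfolding abs_mult using D_t_bound[OF t(1)] state_weight_abs[OF m]
      by (intro mult_mono) auto
    moreover have "(40 * K + 5 * K\<^sup>2 / c) * \<epsilon>\<^sup>2 \<le> B * \<epsilon>\<^sup>2" using B by (intro mult_right_mono) auto
    moreover have "n * (B * \<epsilon> ^ 3) \<le> Suc n * (B * \<epsilon> ^ 3)" using B \<epsilon> by (intro mult_right_mono) auto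
    moreover have "Suc n * (B * \<epsilon> ^ 3) = B * (T - t) * \<epsilon>"
      unfolding T by (simp add: power2_eq_square power3_eq_cube)
    ultimately show ?thesis by (simp add: algebra_simps)
  qed
  also have "\<dots> = u t \<xi> \<eta> + B * ((T - t) + \<epsilon>) * \<epsilon>"
    by (simp add: algebra_simps power2_eq_square)
  finally show ?thesis unfolding B_def .
qed

end

theorem theorem3p1:
  fixes q r :: "nat \<Rightarrow> real" and K c :: real
  assumes "\<forall>m\<in>{0, 1}. \<bar>q m\<bar> < 1 \<and> \<bar>r m\<bar> < 1"
    and "\<exists>m\<in>{0, 1}. q m \<noteq> r m"
    and "c > 0"
  shows "\<exists>C. \<exists>\<epsilon>\<^sub>0>0. \<forall>T (\<phi> :: real \<Rightarrow> real \<Rightarrow> real) (u :: real \<Rightarrow> real \<Rightarrow> real \<Rightarrow> real).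
    solves_final_value_problem (C_sharp_1 q r) T \<phi> u \<longrightarrow>
    regular_solution K T u \<longrightarrow>
    (\<forall>t<T. \<forall>\<xi> \<eta>. D_eta u t \<xi> \<eta> > c) \<longrightarrow>
    (\<forall>t<T. \<forall>\<xi> \<eta>. \<bar>D_xi u t \<xi> \<eta>\<bar> \<le> D_eta u t \<xi> \<eta>) \<longrightarrow>
    (\<forall>\<epsilon> t \<xi> \<eta>. \<forall>m\<in>{0, 1}.
       0 < \<epsilon> \<longrightarrow> \<epsilon> < \<epsilon>\<^sub>0 \<longrightarrow> t < T \<longrightarrow> (T - t) / \<epsilon>\<^sup>2 \<in> \<nat> \<longrightarrow>
       scaled_value q r T \<phi> \<epsilon> t m \<xi> \<eta> \<le> u t \<xi> \<eta> + C * ((T - t) + \<epsilon>) * \<epsilon>)"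
proof -
  define \<rho> where "\<rho> = Max {\<bar>q 0\<bar>, \<bar>q 1\<bar>, \<bar>r 0\<bar>, \<bar>r 1\<bar>}"
  have \<rho>: "\<rho> < 1" using assms(1) unfolding \<rho>_def by (subst Max_less_iff) auto
  have experts: "\<bar>q m\<bar> \<le> \<rho>" "\<bar>r m\<bar> \<le> \<rho>" if "m \<in> {0, 1}" for m
    using that unfolding \<rho>_def by (intro Max_ge; auto)+
  \<comment> \<open>The part of \<open>f\<close> of order \<open>\<epsilon>\<close> is at most \<open>\<epsilon> * K / (2 * c)\<close> and has to fit into \<open>1 - \<rho>\<close>.
    A negative \<open>K\<close>, for which no \<open>u\<close> is regular, is covered by the absolute value.\<close>
  define \<epsilon>\<^sub>0 where "\<epsilon>\<^sub>0 = min 1 (2 * c * (1 - \<rho>) / (\<bar>K\<bar> + 1))"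
  have pos: "\<epsilon>\<^sub>0 > 0" using \<rho> \<open>c > 0\<close> unfolding \<epsilon>\<^sub>0_def by simp
  have small: "\<epsilon> \<le> 1" "\<epsilon> * K \<le> 2 * c * (1 - \<rho>)" if "0 < \<epsilon>" "\<epsilon> < \<epsilon>\<^sub>0" for \<epsilon>
  proof -
    show "\<epsilon> \<le> 1" using that unfolding \<epsilon>\<^sub>0_def by simp
    have "\<epsilon> * (\<bar>K\<bar> + 1) \<le> 2 * c * (1 - \<rho>)"
      using that unfolding \<epsilon>\<^sub>0_def by (simp add: pos_less_divide_eq)
    moreover have "\<epsilon> * K \<le> \<epsilon> * (\<bar>K\<bar> + 1)" using that by (intro mult_left_mono) auto
    ultimately show "\<epsilon> * K \<le> 2 * c * (1 - \<rho>)" by linarith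
  qed
  show ?thesis
  proof (rule exI[of _ "50 * K + 5 * K\<^sup>2 / c"], rule exI[of _ \<epsilon>\<^sub>0], intro conjI pos allI impI ballI)
    fix T t \<epsilon> \<xi> \<eta> :: real and m :: nat
      and \<phi> :: "real \<Rightarrow> real \<Rightarrow> real" and u :: "real \<Rightarrow> real \<Rightarrow> real \<Rightarrow> real"
    assume u: "solves_final_value_problem (C_sharp_1 q r) T \<phi> u" "regular_solution K T u"
      "\<forall>t<T. \<forall>\<xi> \<eta>. D_eta u t \<xi> \<eta> > c" "\<forall>t<T. \<forall>\<xi> \<eta>. \<bar>D_xi u t \<xi> \<eta>\<bar> \<le> D_eta u t \<xi> \<eta>"
      and "m \<in> {0, 1}" "0 < \<epsilon>" "\<epsilon> < \<epsilon>\<^sub>0" "t < T" "(T - t) / \<epsilon>\<^sup>2 \<in> \<nat>"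
    interpret final_value_solution q r \<rho> K c T \<phi> u
      using experts \<rho> assms(2,3) u by unfold_locales auto
    show "scaled_value q r T \<phi> \<epsilon> t m \<xi> \<eta>
        \<le> u t \<xi> \<eta> + (50 * K + 5 * K\<^sup>2 / c) * ((T - t) + \<epsilon>) * \<epsilon>"
      by (rule scaled_value_le) (use small \<open>m \<in> {0, 1}\<close> \<open>0 < \<epsilon>\<close> \<open>\<epsilon> < \<epsilon>\<^sub>0\<close> \<open>t < T\<close>
          \<open>(T - t) / \<epsilon>\<^sup>2 \<in> \<nat>\<close> in auto)
  qed
qed

end
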